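(* Let $k$ be a commutative ring with identity, and let $I$ and $J$ be ideals of a pre-Lie $k$-algebra $A$. Then $$[I,J]=IJ+\sum_{n\ge 0}S_n,$$ where $S_n=((\dots(((JI)A)A)\dots)A)A$, with $n$ factors equal to $A$ on the right of the factor $JI$ (that is, $S_0=JI$ and $S_{n+1}=S_nA$ for every $n\ge 0$).
   Context: A $k$-algebra is a $k$-module with a $k$-bilinear multiplication (not necessarily associative). A pre-Lie $k$-algebra is a $k$-algebra $A$ with $(xy)z-x(yz)=(yx)z-y(xz)$ for all $x,y,z\in A$. An ideal of $A$ is a $k$-submodule $N$ with $xn\in N$ and $nx\in N$ for all $x\in A$, $n\in N$. For $k$-submodules $X,Y$ of $A$, $XY$ denotes the $k$-submodule of all finite sums of products $xy$ with $x\in X$, $y\in Y$. The commutator $[I,J]$ of two ideals $I,J$ of $A$ is the ideal of $A$ generated by $\{\,ij,\ ji\mid i\in I,\ j\in J\,\}$, that is, the smallest ideal of $A$ containing this set. *)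

theory Defs
  imports "HOL-Algebra.Module" "HOL-Algebra.AbelCoset"
begin

text \<open>The multiplication of the algebra is the \<open>mult\<close> field of the \<open>module\<close> record. No unit is
  assumed, so the \<open>one\<close> field is junk. The library locale \<open>algebra\<close> is not suitable, since it
  requires a commutative associative unital multiplication. The base ring is an arbitrary \<open>cring\<close>,
  the zero ring included.\<close>

locale nonassoc_algebra = module k A
  for k :: "('k, 'r) ring_scheme" (structure) and A :: "('k, 'a, 'm) module_scheme" (structure) +
  assumes mult_closed:
      "\<lbrakk>x \<in> carrier A; y \<in> carrier A\<rbrakk> \<Longrightarrow> x \<otimes>\<^bsub>A\<^esub> y \<in> carrier A"
    and mult_add_left:
      "\<lbrakk>x \<in> carrier A; y \<in> carrier A; z \<in> carrier A\<rbrakk> \<Longrightarrow>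
       (x \<oplus>\<^bsub>A\<^esub> y) \<otimes>\<^bsub>A\<^esub> z = x \<otimes>\<^bsub>A\<^esub> z \<oplus>\<^bsub>A\<^esub> y \<otimes>\<^bsub>A\<^esub> z"
    and mult_add_right:
      "\<lbrakk>x \<in> carrier A; y \<in> carrier A; z \<in> carrier A\<rbrakk> \<Longrightarrow>
       x \<otimes>\<^bsub>A\<^esub> (y \<oplus>\<^bsub>A\<^esub> z) = x \<otimes>\<^bsub>A\<^esub> y \<oplus>\<^bsub>A\<^esub> x \<otimes>\<^bsub>A\<^esub> z"
    and mult_smult_left:
      "\<lbrakk>c \<in> carrier k; x \<in> carrier A; y \<in> carrier A\<rbrakk> \<Longrightarrow>
       (c \<odot>\<^bsub>A\<^esub> x) \<otimes>\<^bsub>A\<^esub> y = c \<odot>\<^bsub>A\<^esub> (x \<otimes>\<^bsub>A\<^esub> y)"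
    and mult_smult_right:
      "\<lbrakk>c \<in> carrier k; x \<in> carrier A; y \<in> carrier A\<rbrakk> \<Longrightarrow>
       x \<otimes>\<^bsub>A\<^esub> (c \<odot>\<^bsub>A\<^esub> y) = c \<odot>\<^bsub>A\<^esub> (x \<otimes>\<^bsub>A\<^esub> y)"

locale pre_lie_algebra = nonassoc_algebra +
  assumes pre_lie:
    "\<lbrakk>x \<in> carrier A; y \<in> carrier A; z \<in> carrier A\<rbrakk> \<Longrightarrow>
     (x \<otimes>\<^bsub>A\<^esub> y) \<otimes>\<^bsub>A\<^esub> z \<ominus>\<^bsub>A\<^esub> x \<otimes>\<^bsub>A\<^esub> (y \<otimes>\<^bsub>A\<^esub> z) =
     (y \<otimes>\<^bsub>A\<^esub> x) \<otimes>\<^bsub>A\<^esub> z \<ominus>\<^bsub>A\<^esub> y \<otimes>\<^bsub>A\<^esub> (x \<otimes>\<^bsub>A\<^esub> z)"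

definition algebra_ideal ::
    "'a set \<Rightarrow> ('k, 'r) ring_scheme \<Rightarrow> ('k, 'a, 'm) module_scheme \<Rightarrow> bool" where
  "algebra_ideal N k A \<longleftrightarrow> submodule N k A \<and>
     (\<forall>x \<in> carrier A. \<forall>n \<in> N. x \<otimes>\<^bsub>A\<^esub> n \<in> N \<and> n \<otimes>\<^bsub>A\<^esub> x \<in> N)"

definition generated_algebra_ideal ::
    "('k, 'r) ring_scheme \<Rightarrow> ('k, 'a, 'm) module_scheme \<Rightarrow> 'a set \<Rightarrow> 'a set" where
  "generated_algebra_ideal k A X = \<Inter>{N. algebra_ideal N k A \<and> X \<subseteq> N}"

definition ideal_commutator ::
    "('k, 'r) ring_scheme \<Rightarrow> ('k, 'a, 'm) module_scheme \<Rightarrow> 'a set \<Rightarrow> 'a set \<Rightarrow> 'a set" where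
  "ideal_commutator k A I J =
     generated_algebra_ideal k A ({i \<otimes>\<^bsub>A\<^esub> j | i j. i \<in> I \<and> j \<in> J} \<union> {j \<otimes>\<^bsub>A\<^esub> i | i j. i \<in> I \<and> j \<in> J})"

definition submodule_prod ::
    "('k, 'a, 'm) module_scheme \<Rightarrow> 'a set \<Rightarrow> 'a set \<Rightarrow> 'a set" where
  "submodule_prod A X Y =
     {\<Oplus>\<^bsub>A\<^esub>i\<in>{..<n}. x i \<otimes>\<^bsub>A\<^esub> y i | (n::nat) x y. (\<forall>i<n. x i \<in> X) \<and> (\<forall>i<n. y i \<in> Y)}"

text \<open>The internal sum of a sequence of submodules: all finite sums of elements taken from distinct
  members of the sequence (omitted members contribute zero).\<close>

definition submodule_sum ::
    "('k, 'a, 'm) module_scheme \<Rightarrow> (nat \<Rightarrow> 'a set) \<Rightarrow> 'a set" where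
  "submodule_sum A S = {\<Oplus>\<^bsub>A\<^esub>n\<in>{..<m}. s n | m s. \<forall>n<m. s n \<in> S n}"

primrec right_mult_iter ::
    "('k, 'a, 'm) module_scheme \<Rightarrow> 'a set \<Rightarrow> nat \<Rightarrow> 'a set" where
  "right_mult_iter A X 0 = X"
| "right_mult_iter A X (Suc n) = submodule_prod A (right_mult_iter A X n) (carrier A)"

end

theory Submission
  imports Defs
begin

text \<open>The sum of the \<open>S\<^sub>n\<close> is the right ideal \<open>R\<close> generated by \<open>JI\<close>, so the point is that \<open>IJ + R\<close> is an
  ideal. By the pre-Lie identity \<open>a(xy) = (ax)y - (xa)y + x(ay)\<close>, the product of an ideal and a left
  ideal is a left ideal; by the same identity the elements \<open>u\<close> of \<open>R\<close> with \<open>Au \<subseteq> R\<close> form a right ideal,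
  which contains \<open>JI\<close> and hence is all of \<open>R\<close>. Finally \<open>(ij)a = (ji)a - j(ia) + i(ja)\<close> lies in
  \<open>R + IJ\<close>.\<close>

section \<open>Submodules\<close>

lemma (in abelian_monoid) finsum_lessThan_Suc:
  assumes "f \<in> {..<Suc n} \<rightarrow> carrier G"
  shows "(\<Oplus>i\<in>{..<Suc n}. f i) = (\<Oplus>i\<in>{..<n}. f i) \<oplus> f n"
proof -
  have "f \<in> {..<n} \<rightarrow> carrier G" and "f n \<in> carrier G"
    using assms by (auto simp: Pi_def)
  then show ?thesis
    by (simp add: lessThan_Suc a_comm)
qed

lemma (in abelian_group) minus_eq_minusD:
  assumes eq: "a \<ominus> b = c \<ominus> d"
    and carr: "a \<in> carrier G" "b \<in> carrier G" "c \<in> carrier G" "d \<in> carrier G"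
  shows "a = c \<ominus> d \<oplus> b" and "b = a \<ominus> c \<oplus> d"
proof -
  have "a = a \<ominus> b \<oplus> b"
    using carr by (simp add: minus_eq a_assoc l_neg)
  then show a: "a = c \<ominus> d \<oplus> b"
    by (simp add: eq)
  have "a \<ominus> c \<oplus> d = b \<oplus> (c \<ominus> c) \<oplus> (d \<ominus> d)"
    using carr by (subst a) (simp add: minus_eq a_ac)
  then show "b = a \<ominus> c \<oplus> d"
    using carr by (simp add: minus_eq r_neg)
qed

lemma (in additive_subgroup) minus_closed [intro, simp]:
  assumes "x \<in> H" "y \<in> H"
  shows "x \<ominus> y \<in> H"
  using assms by (simp add: a_minus_def)

sublocale submodule \<subseteq> additive_subgroup H M
  by (rule additive_subgroupI) (rule subgroup_axioms)

context module
begin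

lemma submoduleI_smult:
  assumes sub: "N \<subseteq> carrier M" and zero: "\<zero>\<^bsub>M\<^esub> \<in> N"
    and add: "\<And>u v. \<lbrakk>u \<in> N; v \<in> N\<rbrakk> \<Longrightarrow> u \<oplus>\<^bsub>M\<^esub> v \<in> N"
    and smult: "\<And>c u. \<lbrakk>c \<in> carrier R; u \<in> N\<rbrakk> \<Longrightarrow> c \<odot>\<^bsub>M\<^esub> u \<in> N"
  shows "submodule N R M"
proof (rule submoduleI[OF sub zero _ add smult])
  fix u assume u: "u \<in> N"
  then have "\<ominus>\<^bsub>M\<^esub> u = (\<ominus> \<one>) \<odot>\<^bsub>M\<^esub> u"
    using sub smult_l_minus[of \<one> u] by auto
  then show "\<ominus>\<^bsub>M\<^esub> u \<in> N"
    using smult[of "\<ominus> \<one>" u] u by simp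
qed

lemma submodule_zero: "submodule {\<zero>\<^bsub>M\<^esub>} R M"
  by (rule submoduleI_smult) auto

lemma submodule_Int:
  assumes "submodule N R M" "submodule N' R M"
  shows "submodule (N \<inter> N') R M"
proof -
  interpret N: submodule N R M by fact
  interpret N': submodule N' R M by fact
  show ?thesis
    using N.a_subset by (intro submoduleI_smult) auto
qed

lemma submodule_UN_mono:
  fixes F :: "'i :: linorder \<Rightarrow> 'c set"
  assumes F: "\<And>n. submodule (F n) R M" and "mono F"
  shows "submodule (\<Union>n. F n) R M"
proof (rule submoduleI_smult)
  interpret F: submodule "F n" R M for n by (rule F)
  show "(\<Union>n. F n) \<subseteq> carrier M" "\<zero>\<^bsub>M\<^esub> \<in> (\<Union>n. F n)"
    using F.a_subset by auto
  show "u \<oplus>\<^bsub>M\<^esub> v \<in> (\<Union>n. F n)" if uv: "u \<in> (\<Union>n. F n)" "v \<in> (\<Union>n. F n)" for u v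
  proof -
    obtain m n where "u \<in> F m" "v \<in> F n"
      using uv by blast
    then have "u \<in> F (max m n)" "v \<in> F (max m n)"
      using monoD[OF \<open>mono F\<close>] max.cobounded1 max.cobounded2 by blast+
    then show ?thesis
      by blast
  qed
  show "c \<odot>\<^bsub>M\<^esub> u \<in> (\<Union>n. F n)" if "c \<in> carrier R" "u \<in> (\<Union>n. F n)" for c u
    using that by blast
qed

lemma submodule_set_add:
  assumes "submodule N R M" "submodule N' R M"
  shows "submodule (N <+>\<^bsub>M\<^esub> N') R M"
proof -
  interpret N: submodule N R M by fact
  interpret N': submodule N' R M by fact
  interpret additive_subgroup "N <+>\<^bsub>M\<^esub> N'" M
    using M.add_additive_subgroups N.is_additive_subgroup N'.is_additive_subgroup .
  show ?thesis
  proof (rule submoduleI_smult[OF a_subset zero_closed a_closed])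
    fix c u assume c: "c \<in> carrier R" and "u \<in> N <+>\<^bsub>M\<^esub> N'"
    then obtain x y where xy: "x \<in> N" "y \<in> N'" "u = x \<oplus>\<^bsub>M\<^esub> y"
      by (auto simp: set_add_def')
    then have "c \<odot>\<^bsub>M\<^esub> u = c \<odot>\<^bsub>M\<^esub> x \<oplus>\<^bsub>M\<^esub> c \<odot>\<^bsub>M\<^esub> y"
      using c N.a_subset N'.a_subset by (auto intro: smult_r_distr)
    then show "c \<odot>\<^bsub>M\<^esub> u \<in> N <+>\<^bsub>M\<^esub> N'"
      using c xy(1,2) by (auto simp: set_add_def')
  qed
qed

lemma set_add_superset:
  assumes "submodule N R M" "submodule N' R M"
  shows "N \<subseteq> N <+>\<^bsub>M\<^esub> N'" "N' \<subseteq> N <+>\<^bsub>M\<^esub> N'"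
proof -
  interpret N: submodule N R M by fact
  interpret N': submodule N' R M by fact
  have "u = u \<oplus>\<^bsub>M\<^esub> \<zero>\<^bsub>M\<^esub>" if "u \<in> N" for u
    using that N.a_subset by auto
  then show "N \<subseteq> N <+>\<^bsub>M\<^esub> N'"
    unfolding set_add_def' using N'.zero_closed by blast
  have "u = \<zero>\<^bsub>M\<^esub> \<oplus>\<^bsub>M\<^esub> u" if "u \<in> N'" for u
    using that N'.a_subset by auto
  then show "N' \<subseteq> N <+>\<^bsub>M\<^esub> N'"
    unfolding set_add_def' using N.zero_closed by blast
qed

lemma set_add_least:
  assumes "submodule L R M" "N \<subseteq> L" "N' \<subseteq> L"
  shows "N <+>\<^bsub>M\<^esub> N' \<subseteq> L"
  using assms(2,3) submoduleE(5)[OF assms(1)] by (auto simp: set_add_def')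

primrec partial_submodule_sum :: "(nat \<Rightarrow> 'c set) \<Rightarrow> nat \<Rightarrow> 'c set" where
  "partial_submodule_sum S 0 = {\<zero>\<^bsub>M\<^esub>}"
| "partial_submodule_sum S (Suc m) = partial_submodule_sum S m <+>\<^bsub>M\<^esub> S m"

lemma partial_submodule_sum_eq:
  assumes S: "\<And>n. S n \<subseteq> carrier M"
  shows "partial_submodule_sum S m = {\<Oplus>\<^bsub>M\<^esub>n\<in>{..<m}. s n | s. \<forall>n<m. s n \<in> S n}"
proof (induction m)
  case 0
  show ?case by simp
next
  case (Suc m)
  have finsum_Suc: "(\<Oplus>\<^bsub>M\<^esub>n\<in>{..<Suc m}. s n) = (\<Oplus>\<^bsub>M\<^esub>n\<in>{..<m}. s n) \<oplus>\<^bsub>M\<^esub> s m"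
    if "\<forall>n<Suc m. s n \<in> S n" for s
    using that S by (intro M.finsum_lessThan_Suc) blast
  show ?case
  proof (intro subset_antisym subsetI)
    fix u assume "u \<in> partial_submodule_sum S (Suc m)"
    then obtain s x where s: "\<forall>n<m. s n \<in> S n" and x: "x \<in> S m"
      and u: "u = (\<Oplus>\<^bsub>M\<^esub>n\<in>{..<m}. s n) \<oplus>\<^bsub>M\<^esub> x"
      by (auto simp: Suc.IH set_add_def')
    let ?s = "s(m := x)"
    have mem: "\<forall>n<Suc m. ?s n \<in> S n"
      using x s by (simp add: less_Suc_eq)
    have "(\<Oplus>\<^bsub>M\<^esub>n\<in>{..<m}. ?s n) = (\<Oplus>\<^bsub>M\<^esub>n\<in>{..<m}. s n)"
      using s S by (intro M.finsum_cong') auto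
    then have "u = (\<Oplus>\<^bsub>M\<^esub>n\<in>{..<Suc m}. ?s n)"
      using finsum_Suc[OF mem] u by (simp only: fun_upd_same)
    with mem show "u \<in> {\<Oplus>\<^bsub>M\<^esub>n\<in>{..<Suc m}. s n | s. \<forall>n<Suc m. s n \<in> S n}"
      by blast
  next
    fix u assume "u \<in> {\<Oplus>\<^bsub>M\<^esub>n\<in>{..<Suc m}. s n | s. \<forall>n<Suc m. s n \<in> S n}"
    then obtain s where s: "\<forall>n<Suc m. s n \<in> S n" and u: "u = (\<Oplus>\<^bsub>M\<^esub>n\<in>{..<Suc m}. s n)"
      by blast
    have "(\<Oplus>\<^bsub>M\<^esub>n\<in>{..<m}. s n) \<in> partial_submodule_sum S m"
      using s by (auto simp: Suc.IH)
    then show "u \<in> partial_submodule_sum S (Suc m)"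
      unfolding u finsum_Suc[OF s] using s by (auto simp: set_add_def')
  qed
qed

lemma submodule_sum_eq_UN:
  assumes "\<And>n. S n \<subseteq> carrier M"
  shows "submodule_sum M S = (\<Union>m. partial_submodule_sum S m)"
  using partial_submodule_sum_eq[of S, OF assms] by (auto simp: submodule_sum_def)

lemma submodule_partial_submodule_sum:
  assumes "\<And>n. submodule (S n) R M"
  shows "submodule (partial_submodule_sum S m) R M"
  by (induction m) (simp_all add: assms submodule_zero submodule_set_add)

lemma submodule_submodule_sum:
  assumes S: "\<And>n. submodule (S n) R M"
  shows "submodule (submodule_sum M S) R M"
proof -
  have "mono (partial_submodule_sum S)"
    using set_add_superset(1)[OF submodule_partial_submodule_sum[OF S] S]
    by (simp add: mono_iff_le_Suc)
  with submodule_partial_submodule_sum[OF S] have "submodule (\<Union>m. partial_submodule_sum S m) R M"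
    by (rule submodule_UN_mono)
  then show ?thesis
    by (simp add: submodule_sum_eq_UN submoduleE(1)[OF S])
qed

lemma submodule_sum_superset:
  assumes S: "\<And>n. submodule (S n) R M"
  shows "S n \<subseteq> submodule_sum M S"
proof -
  have "S n \<subseteq> partial_submodule_sum S (Suc n)"
    using set_add_superset(2)[OF submodule_partial_submodule_sum[OF S] S] by simp
  then show ?thesis
    using submodule_sum_eq_UN[of S, OF submoduleE(1)[OF S]] by blast
qed

lemma submodule_sum_least:
  assumes N: "submodule N R M" and S: "\<And>n. S n \<subseteq> N"
  shows "submodule_sum M S \<subseteq> N"
proof -
  interpret N: submodule N R M by fact
  have "partial_submodule_sum S m \<subseteq> N" for m
    by (induction m) (simp_all add: set_add_least[OF N _ S])
  moreover have "S n \<subseteq> carrier M" for n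
    using S N.a_subset by blast
  ultimately show ?thesis
    by (simp add: submodule_sum_eq_UN UN_least)
qed

end

section \<open>Products of submodules and one-sided ideals\<close>

context nonassoc_algebra
begin

abbreviation submodule_mult :: "'a set \<Rightarrow> 'a set \<Rightarrow> 'a set" (infixl \<open>\<star>\<close> 70) where
  "X \<star> Y \<equiv> submodule_prod A X Y"

declare mult_closed [simp, intro]

lemma mult_zero_left:
  assumes "y \<in> carrier A"
  shows "\<zero>\<^bsub>A\<^esub> \<otimes>\<^bsub>A\<^esub> y = \<zero>\<^bsub>A\<^esub>"
  using mult_smult_left[of \<zero> "\<zero>\<^bsub>A\<^esub>" y] assms by simp

lemma mult_zero_right:
  assumes "x \<in> carrier A"
  shows "x \<otimes>\<^bsub>A\<^esub> \<zero>\<^bsub>A\<^esub> = \<zero>\<^bsub>A\<^esub>"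
  using mult_smult_right[of \<zero> x "\<zero>\<^bsub>A\<^esub>"] assms by simp

lemma zero_mem_submodule_prod: "\<zero>\<^bsub>A\<^esub> \<in> X \<star> Y"
  unfolding submodule_prod_def by (force intro: exI[of _ 0])

lemma add_mult_mem_submodule_prod:
  assumes X: "X \<subseteq> carrier A" and Y: "Y \<subseteq> carrier A"
    and u: "u \<in> X \<star> Y" and x: "x \<in> X" and y: "y \<in> Y"
  shows "u \<oplus>\<^bsub>A\<^esub> x \<otimes>\<^bsub>A\<^esub> y \<in> X \<star> Y"
proof -
  obtain n :: nat and f g where u: "u = (\<Oplus>\<^bsub>A\<^esub>i\<in>{..<n}. f i \<otimes>\<^bsub>A\<^esub> g i)"
    and f: "\<forall>i<n. f i \<in> X" and g: "\<forall>i<n. g i \<in> Y"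
    using u unfolding submodule_prod_def by blast
  let ?f = "f(n := x)" and ?g = "g(n := y)"
  have mem: "\<forall>i<Suc n. ?f i \<in> X" "\<forall>i<Suc n. ?g i \<in> Y"
    using f g x y by (auto simp: less_Suc_eq)
  have "(\<Oplus>\<^bsub>A\<^esub>i\<in>{..<n}. ?f i \<otimes>\<^bsub>A\<^esub> ?g i) = u"
    unfolding u using f g X Y by (intro M.finsum_cong') (auto simp: subset_iff)
  then have "u \<oplus>\<^bsub>A\<^esub> x \<otimes>\<^bsub>A\<^esub> y = (\<Oplus>\<^bsub>A\<^esub>i\<in>{..<Suc n}. ?f i \<otimes>\<^bsub>A\<^esub> ?g i)"
    using mem X Y by (subst M.finsum_lessThan_Suc) (auto simp: subset_iff)
  then show ?thesis
    unfolding submodule_prod_def using mem by blast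
qed

lemma submodule_prod_induct [consumes 3, case_names zero add_mult]:
  assumes X: "X \<subseteq> carrier A" and Y: "Y \<subseteq> carrier A" and u: "u \<in> X \<star> Y"
    and zero: "P \<zero>\<^bsub>A\<^esub>"
    and add_mult: "\<And>u x y. \<lbrakk>u \<in> carrier A; P u; x \<in> X; y \<in> Y\<rbrakk> \<Longrightarrow> P (u \<oplus>\<^bsub>A\<^esub> x \<otimes>\<^bsub>A\<^esub> y)"
  shows "P u"
proof -
  obtain n :: nat and f g where u: "u = (\<Oplus>\<^bsub>A\<^esub>i\<in>{..<n}. f i \<otimes>\<^bsub>A\<^esub> g i)"
    and f: "\<forall>i<n. f i \<in> X" and g: "\<forall>i<n. g i \<in> Y"
    using u unfolding submodule_prod_def by blast
  from f g show "P u"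
    unfolding u
  proof (induction n)
    case 0
    then show ?case using zero by simp
  next
    case (Suc n)
    have "(\<Oplus>\<^bsub>A\<^esub>i\<in>{..<n}. f i \<otimes>\<^bsub>A\<^esub> g i) \<in> carrier A"
      using Suc.prems X Y by (intro M.finsum_closed) (auto simp: subset_iff)
    then have "P ((\<Oplus>\<^bsub>A\<^esub>i\<in>{..<n}. f i \<otimes>\<^bsub>A\<^esub> g i) \<oplus>\<^bsub>A\<^esub> f n \<otimes>\<^bsub>A\<^esub> g n)"
      using Suc by (intro add_mult) auto
    then show ?case
      using Suc.prems X Y by (subst M.finsum_lessThan_Suc) (auto simp: subset_iff)
  qed
qed

lemma submodule_prod_closed:
  assumes "X \<subseteq> carrier A" "Y \<subseteq> carrier A"
  shows "X \<star> Y \<subseteq> carrier A"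
proof
  fix u assume "u \<in> X \<star> Y"
  with assms show "u \<in> carrier A"
    by (induction u rule: submodule_prod_induct) (use assms in auto)
qed

lemma mult_mem_submodule_prod:
  assumes "X \<subseteq> carrier A" "Y \<subseteq> carrier A" "x \<in> X" "y \<in> Y"
  shows "x \<otimes>\<^bsub>A\<^esub> y \<in> X \<star> Y"
  using add_mult_mem_submodule_prod[OF assms(1,2) zero_mem_submodule_prod assms(3,4)] assms
  by (auto simp: subset_iff)

lemma add_mem_submodule_prod:
  assumes XY: "X \<subseteq> carrier A" "Y \<subseteq> carrier A" and u: "u \<in> X \<star> Y" and v: "v \<in> X \<star> Y"
  shows "u \<oplus>\<^bsub>A\<^esub> v \<in> X \<star> Y"
  using XY v
proof (induction v rule: submodule_prod_induct)
  case zero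
  then show ?case using u submodule_prod_closed[OF XY] by auto
next
  case (add_mult v x y)
  have "u \<oplus>\<^bsub>A\<^esub> (v \<oplus>\<^bsub>A\<^esub> x \<otimes>\<^bsub>A\<^esub> y) = (u \<oplus>\<^bsub>A\<^esub> v) \<oplus>\<^bsub>A\<^esub> x \<otimes>\<^bsub>A\<^esub> y"
    using add_mult u XY submodule_prod_closed[OF XY] by (auto simp: M.a_assoc subset_iff)
  then show ?case
    using add_mult add_mult_mem_submodule_prod[OF XY] by simp
qed

lemma smult_mem_submodule_prod:
  assumes X: "submodule X k A" and Y: "Y \<subseteq> carrier A"
    and c: "c \<in> carrier k" and u: "u \<in> X \<star> Y"
  shows "c \<odot>\<^bsub>A\<^esub> u \<in> X \<star> Y"
proof -
  interpret X: submodule X k A by fact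
  note XY = X.a_subset Y
  from XY u show ?thesis
  proof (induction u rule: submodule_prod_induct)
    case zero
    then show ?case using c zero_mem_submodule_prod by simp
  next
    case (add_mult u x y)
    then have "c \<odot>\<^bsub>A\<^esub> (u \<oplus>\<^bsub>A\<^esub> x \<otimes>\<^bsub>A\<^esub> y) = c \<odot>\<^bsub>A\<^esub> u \<oplus>\<^bsub>A\<^esub> (c \<odot>\<^bsub>A\<^esub> x) \<otimes>\<^bsub>A\<^esub> y"
      using c XY by (auto simp: smult_r_distr mult_smult_left subset_iff)
    then show ?case
      using c add_mult add_mult_mem_submodule_prod[OF XY] by simp
  qed
qed

lemma submodule_submodule_prod:
  assumes X: "submodule X k A" and Y: "Y \<subseteq> carrier A"
  shows "submodule (X \<star> Y) k A"
  using submoduleE(1)[OF X] Y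
  by (intro submoduleI_smult submodule_prod_closed zero_mem_submodule_prod add_mem_submodule_prod
      smult_mem_submodule_prod[OF X])

lemma submodule_prod_subset_iff:
  assumes "submodule N k A" and X: "X \<subseteq> carrier A" and Y: "Y \<subseteq> carrier A"
  shows "X \<star> Y \<subseteq> N \<longleftrightarrow> (\<forall>x\<in>X. \<forall>y\<in>Y. x \<otimes>\<^bsub>A\<^esub> y \<in> N)"
proof
  interpret N: submodule N k A by fact
  assume mem: "\<forall>x\<in>X. \<forall>y\<in>Y. x \<otimes>\<^bsub>A\<^esub> y \<in> N"
  show "X \<star> Y \<subseteq> N"
  proof
    fix u assume "u \<in> X \<star> Y"
    with X Y show "u \<in> N"
      by (induction u rule: submodule_prod_induct) (use mem in auto)
  qed
qed (use mult_mem_submodule_prod[OF X Y] in blast)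

definition left_transporter :: "'a set \<Rightarrow> 'a set \<Rightarrow> 'a set" where
  "left_transporter B N = {u \<in> carrier A. \<forall>b\<in>B. b \<otimes>\<^bsub>A\<^esub> u \<in> N}"

definition right_transporter :: "'a set \<Rightarrow> 'a set \<Rightarrow> 'a set" where
  "right_transporter B N = {u \<in> carrier A. \<forall>b\<in>B. u \<otimes>\<^bsub>A\<^esub> b \<in> N}"

lemma submodule_left_transporter:
  assumes "submodule N k A" "B \<subseteq> carrier A"
  shows "submodule (left_transporter B N) k A"
proof -
  interpret N: submodule N k A by fact
  show ?thesis
    using assms(2) unfolding left_transporter_def
    by (intro submoduleI_smult)
      (auto simp: mult_zero_right mult_add_right mult_smult_right subset_iff)
qed

lemma submodule_right_transporter:
  assumes "submodule N k A" "B \<subseteq> carrier A"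
  shows "submodule (right_transporter B N) k A"
proof -
  interpret N: submodule N k A by fact
  show ?thesis
    using assms(2) unfolding right_transporter_def
    by (intro submoduleI_smult)
      (auto simp: mult_zero_left mult_add_left mult_smult_left subset_iff)
qed

lemma left_transporter_mono: "N \<subseteq> N' \<Longrightarrow> left_transporter B N \<subseteq> left_transporter B N'"
  by (auto simp: left_transporter_def)

lemma right_transporter_mono: "N \<subseteq> N' \<Longrightarrow> right_transporter B N \<subseteq> right_transporter B N'"
  by (auto simp: right_transporter_def)

definition left_ideal :: "'a set \<Rightarrow> bool" where
  "left_ideal N \<longleftrightarrow> submodule N k A \<and> N \<subseteq> left_transporter (carrier A) N"

definition right_ideal :: "'a set \<Rightarrow> bool" where
  "right_ideal N \<longleftrightarrow> submodule N k A \<and> N \<subseteq> right_transporter (carrier A) N"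

lemma left_ideal_imp_submodule: "left_ideal N \<Longrightarrow> submodule N k A"
  by (simp add: left_ideal_def)

lemma right_ideal_imp_submodule: "right_ideal N \<Longrightarrow> submodule N k A"
  by (simp add: right_ideal_def)

lemma left_ideal_mult_mem: "\<lbrakk>left_ideal N; a \<in> carrier A; u \<in> N\<rbrakk> \<Longrightarrow> a \<otimes>\<^bsub>A\<^esub> u \<in> N"
  by (auto simp: left_ideal_def left_transporter_def)

lemma right_ideal_mult_mem: "\<lbrakk>right_ideal N; u \<in> N; a \<in> carrier A\<rbrakk> \<Longrightarrow> u \<otimes>\<^bsub>A\<^esub> a \<in> N"
  by (auto simp: right_ideal_def right_transporter_def)

lemma algebra_ideal_iff: "algebra_ideal N k A \<longleftrightarrow> left_ideal N \<and> right_ideal N"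
  using submoduleE(1)[of N]
  by (auto simp: algebra_ideal_def left_ideal_def right_ideal_def left_transporter_def
      right_transporter_def)

lemma left_ideal_set_add:
  assumes N: "left_ideal N" and N': "left_ideal N'"
  shows "left_ideal (N <+>\<^bsub>A\<^esub> N')"
  unfolding left_ideal_def
proof
  note sub = left_ideal_imp_submodule[OF N] left_ideal_imp_submodule[OF N']
  note mono = set_add_superset[OF sub, THEN left_transporter_mono]
  show sum: "submodule (N <+>\<^bsub>A\<^esub> N') k A"
    using sub by (rule submodule_set_add)
  show "N <+>\<^bsub>A\<^esub> N' \<subseteq> left_transporter (carrier A) (N <+>\<^bsub>A\<^esub> N')"
    using N N' mono unfolding left_ideal_def
    by (intro set_add_least submodule_left_transporter sum) blast+
qed

definition right_ideal_hull :: "'a set \<Rightarrow> 'a set" where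
  "right_ideal_hull X = submodule_sum A (right_mult_iter A X)"

lemma submodule_right_mult_iter:
  assumes "submodule X k A"
  shows "submodule (right_mult_iter A X n) k A"
  by (induction n) (simp_all add: assms submodule_submodule_prod)

lemma right_ideal_right_ideal_hull:
  assumes X: "submodule X k A"
  shows "right_ideal (right_ideal_hull X)"
proof -
  let ?S = "right_mult_iter A X" and ?R = "right_ideal_hull X"
  note S = submodule_right_mult_iter[OF X]
  note S_subset = submodule_sum_superset[of ?S, OF S, folded right_ideal_hull_def]
  have R: "submodule ?R k A"
    unfolding right_ideal_hull_def using S by (rule submodule_submodule_sum)
  have "?S n \<subseteq> right_transporter (carrier A) ?R" for n
  proof -
    have "?S n \<star> carrier A \<subseteq> ?R"
      using S_subset[of "Suc n"] by simp
    then show ?thesis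
      using submoduleE(1)[OF S] submodule_prod_subset_iff[OF R]
      unfolding right_transporter_def by blast
  qed
  then have "submodule_sum A ?S \<subseteq> right_transporter (carrier A) ?R"
    by (intro submodule_sum_least submodule_right_transporter R) auto
  with R show ?thesis
    by (simp add: right_ideal_def right_ideal_hull_def)
qed

lemma right_ideal_hull_superset:
  assumes "submodule X k A"
  shows "X \<subseteq> right_ideal_hull X"
  using submodule_sum_superset[of "right_mult_iter A X" 0, OF submodule_right_mult_iter[OF assms]]
  by (simp add: right_ideal_hull_def)

lemma right_ideal_hull_least:
  assumes N: "right_ideal N" and "X \<subseteq> N"
  shows "right_ideal_hull X \<subseteq> N"
  unfolding right_ideal_hull_def
proof (rule submodule_sum_least)
  show sub: "submodule N k A"
    using N by (rule right_ideal_imp_submodule)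
  show "right_mult_iter A X n \<subseteq> N" for n
  proof (induction n)
    case 0
    then show ?case using \<open>X \<subseteq> N\<close> by simp
  next
    case (Suc n)
    have "right_mult_iter A X n \<star> carrier A \<subseteq> N"
      using Suc submoduleE(1)[OF sub] right_ideal_mult_mem[OF N]
      by (subst submodule_prod_subset_iff[OF sub]) auto
    then show ?case by simp
  qed
qed

lemma generated_algebra_ideal_eqI:
  assumes "algebra_ideal N k A" "X \<subseteq> N"
    and "\<And>L. \<lbrakk>algebra_ideal L k A; X \<subseteq> L\<rbrakk> \<Longrightarrow> N \<subseteq> L"
  shows "generated_algebra_ideal k A X = N"
  unfolding generated_algebra_ideal_def using assms by blast

lemma ideal_commutator_eq_generated:
  assumes "I \<subseteq> carrier A" "J \<subseteq> carrier A"
  shows "ideal_commutator k A I J = generated_algebra_ideal k A (I \<star> J \<union> J \<star> I)"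
proof -
  have "{i \<otimes>\<^bsub>A\<^esub> j | i j. i \<in> I \<and> j \<in> J} \<union> {j \<otimes>\<^bsub>A\<^esub> i | i j. i \<in> I \<and> j \<in> J} \<subseteq> N
      \<longleftrightarrow> I \<star> J \<union> J \<star> I \<subseteq> N" if "submodule N k A" for N
    unfolding Un_subset_iff submodule_prod_subset_iff[OF that assms]
      submodule_prod_subset_iff[OF that assms(2,1)] by blast
  then show ?thesis
    unfolding ideal_commutator_def generated_algebra_ideal_def
    by (intro arg_cong[of _ _ Inter] Collect_cong conj_cong refl) (simp add: algebra_ideal_def)
qed

end

section \<open>Products of ideals in a pre-Lie algebra\<close>

context pre_lie_algebra
begin

lemma left_assoc_mult_eq:
  assumes "x \<in> carrier A" "y \<in> carrier A" "z \<in> carrier A"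
  shows "(x \<otimes>\<^bsub>A\<^esub> y) \<otimes>\<^bsub>A\<^esub> z =
    (y \<otimes>\<^bsub>A\<^esub> x) \<otimes>\<^bsub>A\<^esub> z \<ominus>\<^bsub>A\<^esub> y \<otimes>\<^bsub>A\<^esub> (x \<otimes>\<^bsub>A\<^esub> z) \<oplus>\<^bsub>A\<^esub> x \<otimes>\<^bsub>A\<^esub> (y \<otimes>\<^bsub>A\<^esub> z)"
  using M.minus_eq_minusD(1)[OF pre_lie[OF assms]] assms by simp

lemma right_assoc_mult_eq:
  assumes "x \<in> carrier A" "y \<in> carrier A" "z \<in> carrier A"
  shows "x \<otimes>\<^bsub>A\<^esub> (y \<otimes>\<^bsub>A\<^esub> z) =
    (x \<otimes>\<^bsub>A\<^esub> y) \<otimes>\<^bsub>A\<^esub> z \<ominus>\<^bsub>A\<^esub> (y \<otimes>\<^bsub>A\<^esub> x) \<otimes>\<^bsub>A\<^esub> z \<oplus>\<^bsub>A\<^esub> y \<otimes>\<^bsub>A\<^esub> (x \<otimes>\<^bsub>A\<^esub> z)"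
  using M.minus_eq_minusD(2)[OF pre_lie[OF assms]] assms by simp

lemma left_ideal_submodule_prod:
  assumes I: "algebra_ideal I k A" and J: "left_ideal J"
  shows "left_ideal (I \<star> J)"
proof -
  have left: "left_ideal I" and right: "right_ideal I"
    using I by (auto simp: algebra_ideal_iff)
  interpret I: submodule I k A using left by (rule left_ideal_imp_submodule)
  interpret J: submodule J k A using J by (rule left_ideal_imp_submodule)
  note mult_mem = mult_mem_submodule_prod[OF I.a_subset J.a_subset]
  have sub: "submodule (I \<star> J) k A"
    using I.submodule_axioms J.a_subset by (rule submodule_submodule_prod)
  then interpret IJ: submodule "I \<star> J" k A .
  have "a \<otimes>\<^bsub>A\<^esub> (i \<otimes>\<^bsub>A\<^esub> j) \<in> I \<star> J" if a: "a \<in> carrier A" and i: "i \<in> I" and j: "j \<in> J" for a i j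
  proof -
    have "(a \<otimes>\<^bsub>A\<^esub> i) \<otimes>\<^bsub>A\<^esub> j \<in> I \<star> J" "(i \<otimes>\<^bsub>A\<^esub> a) \<otimes>\<^bsub>A\<^esub> j \<in> I \<star> J" "i \<otimes>\<^bsub>A\<^esub> (a \<otimes>\<^bsub>A\<^esub> j) \<in> I \<star> J"
      using mult_mem left_ideal_mult_mem[OF left a i] right_ideal_mult_mem[OF right i a]
        left_ideal_mult_mem[OF J a j] i j by blast+
    then show ?thesis
      using right_assoc_mult_eq[of a i j] a i j I.a_subset J.a_subset by auto
  qed
  then have "I \<star> J \<subseteq> left_transporter (carrier A) (I \<star> J)"
    using I.a_subset J.a_subset
    by (subst submodule_prod_subset_iff[OF submodule_left_transporter[OF sub]])
      (auto simp: left_transporter_def)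
  with sub show ?thesis
    by (simp add: left_ideal_def)
qed

lemma left_ideal_right_ideal_hull:
  assumes X: "left_ideal X"
  shows "left_ideal (right_ideal_hull X)"
proof -
  let ?R = "right_ideal_hull X"
  let ?N = "?R \<inter> left_transporter (carrier A) ?R"
  have X_sub: "submodule X k A"
    using X by (rule left_ideal_imp_submodule)
  have R: "right_ideal ?R"
    using X_sub by (rule right_ideal_right_ideal_hull)
  then have R_sub: "submodule ?R k A"
    by (rule right_ideal_imp_submodule)
  then interpret R: submodule ?R k A .
  have N_sub: "submodule ?N k A"
    using R_sub submodule_left_transporter[OF R_sub] by (intro submodule_Int) auto
  have "a \<otimes>\<^bsub>A\<^esub> (u \<otimes>\<^bsub>A\<^esub> b) \<in> ?R"
    if u: "u \<in> ?N" and a: "a \<in> carrier A" and b: "b \<in> carrier A" for u a b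
  proof -
    have "u \<in> ?R" "a \<otimes>\<^bsub>A\<^esub> u \<in> ?R"
      using u a by (auto simp: left_transporter_def)
    then have "(a \<otimes>\<^bsub>A\<^esub> u) \<otimes>\<^bsub>A\<^esub> b \<in> ?R" "(u \<otimes>\<^bsub>A\<^esub> a) \<otimes>\<^bsub>A\<^esub> b \<in> ?R" "u \<otimes>\<^bsub>A\<^esub> (a \<otimes>\<^bsub>A\<^esub> b) \<in> ?R"
      using right_ideal_mult_mem[OF R] mult_closed a b by blast+
    then show ?thesis
      using right_assoc_mult_eq[of a u b] a b \<open>u \<in> ?R\<close> R.a_subset by auto
  qed
  then have "right_ideal ?N"
    using N_sub R.a_subset right_ideal_mult_mem[OF R]
    by (auto simp: right_ideal_def right_transporter_def left_transporter_def)
  moreover have "X \<subseteq> ?N"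
    using right_ideal_hull_superset[OF X_sub] X by (auto simp: left_ideal_def left_transporter_def)
  ultimately have "?R \<subseteq> ?N"
    by (rule right_ideal_hull_least)
  with R_sub show ?thesis
    by (simp add: left_ideal_def)
qed

lemma submodule_prod_subset_right_transporter:
  assumes I: "right_ideal I" and J: "right_ideal J"
  shows "I \<star> J \<subseteq> right_transporter (carrier A) (I \<star> J <+>\<^bsub>A\<^esub> right_ideal_hull (J \<star> I))"
    (is "_ \<subseteq> right_transporter _ (_ <+>\<^bsub>A\<^esub> ?R)")
proof -
  interpret I: submodule I k A using I by (rule right_ideal_imp_submodule)
  interpret J: submodule J k A using J by (rule right_ideal_imp_submodule)
  have IJ_sub: "submodule (I \<star> J) k A" and JI_sub: "submodule (J \<star> I) k A"
    using submodule_submodule_prod I.submodule_axioms J.submodule_axioms I.a_subset J.a_subset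
    by blast+
  have R: "right_ideal ?R"
    using JI_sub by (rule right_ideal_right_ideal_hull)
  then interpret R: submodule ?R k A by (rule right_ideal_imp_submodule)
  have sum_sub: "submodule (I \<star> J <+>\<^bsub>A\<^esub> ?R) k A"
    using IJ_sub R.submodule_axioms by (rule submodule_set_add)
  have "(i \<otimes>\<^bsub>A\<^esub> j) \<otimes>\<^bsub>A\<^esub> a \<in> I \<star> J <+>\<^bsub>A\<^esub> ?R"
    if i: "i \<in> I" and j: "j \<in> J" and a: "a \<in> carrier A" for i j a
  proof -
    have mem_R: "v \<otimes>\<^bsub>A\<^esub> w \<in> ?R" if "v \<in> J" "w \<in> I" for v w
      using mult_mem_submodule_prod[OF J.a_subset I.a_subset that] right_ideal_hull_superset[OF JI_sub]
      by blast
    have "(j \<otimes>\<^bsub>A\<^esub> i) \<otimes>\<^bsub>A\<^esub> a \<in> ?R" and "j \<otimes>\<^bsub>A\<^esub> (i \<otimes>\<^bsub>A\<^esub> a) \<in> ?R"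
      using right_ideal_mult_mem[OF R mem_R[OF j i] a] mem_R[OF j right_ideal_mult_mem[OF I i a]] .
    then have "(j \<otimes>\<^bsub>A\<^esub> i) \<otimes>\<^bsub>A\<^esub> a \<ominus>\<^bsub>A\<^esub> j \<otimes>\<^bsub>A\<^esub> (i \<otimes>\<^bsub>A\<^esub> a) \<in> I \<star> J <+>\<^bsub>A\<^esub> ?R"
      using set_add_superset(2)[OF IJ_sub R.submodule_axioms] by blast
    moreover have "i \<otimes>\<^bsub>A\<^esub> (j \<otimes>\<^bsub>A\<^esub> a) \<in> I \<star> J <+>\<^bsub>A\<^esub> ?R"
      using mult_mem_submodule_prod[OF I.a_subset J.a_subset i right_ideal_mult_mem[OF J j a]]
        set_add_superset(1)[OF IJ_sub R.submodule_axioms] by blast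
    moreover have "i \<in> carrier A" "j \<in> carrier A"
      using i j I.a_subset J.a_subset by auto
    ultimately show ?thesis
      using left_assoc_mult_eq[of i j a] a submoduleE(5)[OF sum_sub] by simp
  qed
  then show ?thesis
    using I.a_subset J.a_subset
    by (subst submodule_prod_subset_iff[OF submodule_right_transporter[OF sum_sub]])
      (auto simp: right_transporter_def)
qed

lemma algebra_ideal_submodule_prod_add_hull:
  assumes I: "algebra_ideal I k A" and J: "algebra_ideal J k A"
  shows "algebra_ideal (I \<star> J <+>\<^bsub>A\<^esub> right_ideal_hull (J \<star> I)) k A"
    (is "algebra_ideal (?IJ <+>\<^bsub>A\<^esub> ?R) k A")
proof -
  have left: "left_ideal I" "left_ideal J" and right: "right_ideal I" "right_ideal J"
    using I J by (auto simp: algebra_ideal_iff)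
  have IJ: "left_ideal ?IJ" and JI: "left_ideal (J \<star> I)"
    using I J left by (auto intro: left_ideal_submodule_prod)
  have R_left: "left_ideal ?R" and R_right: "right_ideal ?R"
    using JI left_ideal_right_ideal_hull right_ideal_right_ideal_hull left_ideal_imp_submodule
    by auto
  have sum_left: "left_ideal (?IJ <+>\<^bsub>A\<^esub> ?R)"
    using IJ R_left by (rule left_ideal_set_add)
  then have sum_sub: "submodule (?IJ <+>\<^bsub>A\<^esub> ?R) k A"
    by (rule left_ideal_imp_submodule)
  have "?IJ <+>\<^bsub>A\<^esub> ?R \<subseteq> right_transporter (carrier A) (?IJ <+>\<^bsub>A\<^esub> ?R)"
  proof (intro set_add_least submodule_right_transporter sum_sub)
    show "?IJ \<subseteq> right_transporter (carrier A) (?IJ <+>\<^bsub>A\<^esub> ?R)"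
      using right by (rule submodule_prod_subset_right_transporter)
    have "?R \<subseteq> right_transporter (carrier A) ?R"
      using R_right by (simp add: right_ideal_def)
    also have "\<dots> \<subseteq> right_transporter (carrier A) (?IJ <+>\<^bsub>A\<^esub> ?R)"
      using IJ R_left
      by (intro right_transporter_mono set_add_superset(2) left_ideal_imp_submodule)
    finally show "?R \<subseteq> right_transporter (carrier A) (?IJ <+>\<^bsub>A\<^esub> ?R)" .
  qed simp
  then show ?thesis
    using sum_left sum_sub by (simp add: algebra_ideal_iff right_ideal_def)
qed

end

theorem proposition12:
  fixes k :: "('k, 'r) ring_scheme" and A :: "('k, 'a, 'm) module_scheme" and I J :: "'a set"
  assumes "pre_lie_algebra k A"
    and "algebra_ideal I k A"
    and "algebra_ideal J k A"
  shows "ideal_commutator k A I J =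
    submodule_prod A I J <+>\<^bsub>A\<^esub>
    submodule_sum A (\<lambda>n. right_mult_iter A (submodule_prod A J I) n)"
proof -
  interpret pre_lie_algebra k A by fact
  let ?R = "right_ideal_hull (J \<star> I)"
  have I: "submodule I k A" and J: "submodule J k A"
    using assms(2,3) by (auto simp: algebra_ideal_def)
  note carr = submoduleE(1)[OF I] submoduleE(1)[OF J]
  have IJ: "submodule (I \<star> J) k A" and JI: "submodule (J \<star> I) k A"
    using I J carr by (auto intro: submodule_submodule_prod)
  have R: "submodule ?R k A"
    using JI by (rule right_ideal_right_ideal_hull[THEN right_ideal_imp_submodule])
  show ?thesis
    unfolding ideal_commutator_eq_generated[OF carr] right_ideal_hull_def[symmetric]
  proof (rule generated_algebra_ideal_eqI)
    show "algebra_ideal (I \<star> J <+>\<^bsub>A\<^esub> ?R) k A"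
      using assms(2,3) by (rule algebra_ideal_submodule_prod_add_hull)
    show "I \<star> J \<union> J \<star> I \<subseteq> I \<star> J <+>\<^bsub>A\<^esub> ?R"
      using set_add_superset[OF IJ R] right_ideal_hull_superset[OF JI] by blast
    show "I \<star> J <+>\<^bsub>A\<^esub> ?R \<subseteq> N" if "algebra_ideal N k A" "I \<star> J \<union> J \<star> I \<subseteq> N" for N
      using that right_ideal_hull_least
      by (intro set_add_least) (auto simp: algebra_ideal_iff right_ideal_def)
  qed
qed

end
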